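(* For every integer $k\ge 3$, the $k$-total cut complex of the squared cycle graph $W_{3k+1}$ is homotopy equivalent to the $3$-sphere: $\Delta_k^t(W_{3k+1})\simeq \mathbb{S}^3$.
   Context: The squared cycle graph $W_n$ is the graph with vertex set $[n]=\{1,\dots,n\}$ and edge set $\{\{i,i+1 \bmod n\},\{i,i+2 \bmod n\} : i=1,\dots,n\}$. For a graph $G=(V,E)$ and $k\ge 1$, the $k$-total cut complex $\Delta_k^t(G)$ is the simplicial complex on $V$ whose facets are the complements $V\setminus S$ of independent sets $S$ of $G$ with $|S|=k$; equivalently, $\sigma\subseteq V$ is a face iff $V\setminus\sigma$ contains an independent set of size $k$. *)

theory Defs
  imports "HOL-Analysis.Analysis"
begin

definition sqcycle_adj :: "nat \<Rightarrow> nat \<Rightarrow> nat \<Rightarrow> bool" where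
  "sqcycle_adj n i j \<longleftrightarrow> i \<in> {1..n} \<and> j \<in> {1..n} \<and> i \<noteq> j \<and>
     ((int j - int i) mod int n \<in> {1, 2} \<or> (int i - int j) mod int n \<in> {1, 2})"

definition independent_set :: "'a set \<Rightarrow> ('a \<Rightarrow> 'a \<Rightarrow> bool) \<Rightarrow> 'a set \<Rightarrow> bool" where
  "independent_set V E S \<longleftrightarrow> S \<subseteq> V \<and> (\<forall>u\<in>S. \<forall>v\<in>S. \<not> E u v)"

definition total_cut_complex :: "nat \<Rightarrow> 'a set \<Rightarrow> ('a \<Rightarrow> 'a \<Rightarrow> bool) \<Rightarrow> 'a set set" where
  "total_cut_complex k V E =
     {\<sigma>. \<sigma> \<subseteq> V \<and> (\<exists>S. S \<subseteq> V - \<sigma> \<and> independent_set V E S \<and> card S = k)}"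

text \<open>Geometric realization of a (finite) simplicial complex K on vertex set V,
  as a subset of the function space 'a \<Rightarrow> real (product topology): points with
  nonnegative barycentric coordinates summing to 1, supported on a face of K.\<close>
definition geom_realization :: "'a set \<Rightarrow> 'a set set \<Rightarrow> ('a \<Rightarrow> real) set" where
  "geom_realization V K =
     {x. (\<forall>v. 0 \<le> x v) \<and> {v. x v \<noteq> 0} \<subseteq> V \<and> sum x V = 1 \<and> {v. x v \<noteq> 0} \<in> K}"

end

theory Submission
  imports Defs
begin

text \<open>
  Multiplication by 3 modulo \<open>n = 3 k + 1\<close> turns the independent sets of size \<open>k\<close> into the
  arcs of \<open>k\<close> consecutive residues, so the complex becomes the complex \<open>K\<^sub>k\<close> of all sets of
  residues that miss such an arc. If every face containing \<open>e\<close> stays a face after adding a vertex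
  \<open>w \<notin> e\<close>, then all faces containing \<open>e\<close> can be collapsed away. Collapses of this
  kind remove the vertices \<open>0\<close>, \<open>k\<close> and \<open>2 k\<close> from \<open>K\<^sub>k\<close>, and what remains is
  isomorphic to \<open>K\<close> for \<open>k - 1\<close>. For \<open>k = 3\<close> the even residues modulo 10 can be removed one
  after the other, which leaves the boundary of the 4-simplex on the odd ones.
\<close>

section \<open>Geometric realizations and collapses\<close>

lemma continuous_on_coordinate: "continuous_on S (\<lambda>x. x i :: real)"
  by (rule continuous_on_subset[OF continuous_on_product_coordinates]) simp

lemma continuous_on_Min_coordinates:
  assumes "finite e" "e \<noteq> {}"
  shows "continuous_on S (\<lambda>x. Min (x ` e) :: real)"
  using assms
proof (induction rule: finite_ne_induct)
  case (singleton v)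
  then show ?case by (simp add: continuous_on_coordinate)
next
  case (insert v e)
  then have "Min (x ` insert v e) = min (x v) (Min (x ` e))" for x :: "'a \<Rightarrow> real"
    by simp
  then show ?case
    by (simp only: continuous_on_min continuous_on_coordinate insert.IH)
qed

text \<open>Lets a deleted vertex also leave the ambient vertex set, once no face contains
  it.\<close>

lemma geom_realization_cong:
  assumes "finite V" "W \<subseteq> V" "K \<subseteq> Pow W"
  shows "geom_realization V K = geom_realization W K"
proof -
  have "sum x V = sum x W" if "{v. x v \<noteq> (0::real)} \<subseteq> W" for x
    using that assms by (intro sum.mono_neutral_right) auto
  moreover have "{v. x v \<noteq> (0::real)} \<subseteq> V \<and> {v. x v \<noteq> 0} \<in> K \<longleftrightarrow>
      {v. x v \<noteq> 0} \<subseteq> W \<and> {v. x v \<noteq> 0} \<in> K" for x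
    using assms by auto
  ultimately show ?thesis
    unfolding geom_realization_def by (intro Collect_cong) metis
qed

text \<open>The faces containing \<open>e\<close> pair off as \<open>\<sigma>\<close> and
  \<open>insert w \<sigma>\<close> with \<open>w \<notin> \<sigma>\<close>, so they can all be
  collapsed together; \<open>cone\<close> says that no face lacks its partner.\<close>

lemma homotopy_eqv_delete_face:
  assumes V: "finite V" "K \<subseteq> Pow V"
    and down: "\<And>\<sigma> \<tau>. \<sigma> \<in> K \<Longrightarrow> \<tau> \<subseteq> \<sigma> \<Longrightarrow> \<tau> \<in> K"
    and e: "e \<noteq> {}" "e \<subseteq> V" and w: "w \<in> V" "w \<notin> e"
    and cone: "\<And>\<sigma>. \<sigma> \<in> K \<Longrightarrow> e \<subseteq> \<sigma> \<Longrightarrow> insert w \<sigma> \<in> K"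
  shows "geom_realization V K homotopy_eqv geom_realization V {\<sigma> \<in> K. \<not> e \<subseteq> \<sigma>}"
proof -
  \<comment> \<open>The deformation moves the smallest weight on \<open>e\<close> from every vertex of \<open>e\<close> to \<open>w\<close>.\<close>
  have fe: "finite e"
    using V e finite_subset by blast
  define t where "t x = Min (x ` e)" for x :: "'a \<Rightarrow> real"
  define h where "h s x v = x v - s * t x * indicator e v + s * (real (card e) * t x) * indicator {w} v"
    for s x v
  let ?X = "geom_realization V K" and ?Y = "geom_realization V {\<sigma> \<in> K. \<not> e \<subseteq> \<sigma>}"
  have t_le: "t x \<le> x v" if "v \<in> e" for x v
    using that fe by (simp add: t_def)
  have t_attained: "\<exists>v\<in>e. t x = x v" for x
    unfolding t_def using Min_in[of "x ` e"] fe e by fastforce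
  have h_nonneg: "0 \<le> h s x v" if "\<forall>v. 0 \<le> x v" "0 \<le> s" "s \<le> 1" for s x v
  proof -
    have t0: "0 \<le> t x"
      using t_attained that(1) by metis
    have "s * t x \<le> 1 * t x"
      using that t0 by (intro mult_right_mono) auto
    then have "s * t x \<le> x v" if "v \<in> e"
      using t_le[OF that, of x] by simp
    moreover have "0 \<le> s * (real (card e) * t x)"
      using that t0 by simp
    ultimately show ?thesis
      using that w by (auto simp: h_def indicator_def)
  qed
  have h_sum: "sum (h s x) V = sum x V" for s x
  proof -
    have "sum (h s x) V = sum x V - s * t x * sum (indicator e) V
            + s * (real (card e) * t x) * sum (indicator {w}) V"
      by (simp add: h_def sum.distrib sum_subtractf sum_distrib_left)
    also have "sum (indicator e) V = real (card e)"
      using V e by (simp add: indicator_def of_bool_def sum.If_cases Int_absorb1)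
    also have "sum (indicator {w}) V = (1::real)"
      using V w by (simp add: indicator_def of_bool_def sum.If_cases Int_absorb1)
    finally show ?thesis by simp
  qed
  have h_fix: "h s x = x" if "t x = 0" for s x
    using that by (simp add: h_def fun_eq_iff)
  \<comment> \<open>Points with \<open>t x = 0\<close> stay where they are. For all others the
    support contains \<open>e\<close>, so \<open>cone\<close> allows weight to appear at
    \<open>w\<close>.\<close>
  have h_in: "h s x \<in> ?X" if x: "x \<in> ?X" and s: "0 \<le> s" "s \<le> 1" for s x
  proof (cases "t x = 0")
    case True
    then show ?thesis using x h_fix by simp
  next
    case False
    have x0: "\<forall>v. 0 \<le> x v"
      using x by (simp add: geom_realization_def)
    have "0 < t x"
      using False t_attained[of x] x0 by (metis less_eq_real_def)
    then have e_sub: "e \<subseteq> {v. x v \<noteq> 0}"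
      using t_le[of _ x] by force
    then have "insert w {v. x v \<noteq> 0} \<in> K"
      using x cone by (simp add: geom_realization_def)
    moreover have "{v. h s x v \<noteq> 0} \<subseteq> insert w {v. x v \<noteq> 0}"
      using e_sub by (auto simp: h_def indicator_def split: if_splits)
    ultimately have "{v. h s x v \<noteq> 0} \<in> K"
      by (rule down)
    moreover from this have "{v. h s x v \<noteq> 0} \<subseteq> V"
      using V by blast
    ultimately show ?thesis
      using x s x0 h_nonneg[OF x0] h_sum[of s x] by (simp add: geom_realization_def)
  qed
  have r_in: "h 1 x \<in> ?Y" if x: "x \<in> ?X" for x
  proof -
    \<comment> \<open>At time 1 a vertex where the minimum is attained has lost all its
      weight.\<close>
    obtain u where "u \<in> e" "t x = x u"
      using t_attained by blast
    then have "h 1 x u = 0"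
      using w by (auto simp: h_def indicator_def)
    then have "\<not> e \<subseteq> {v. h 1 x v \<noteq> 0}"
      using \<open>u \<in> e\<close> by blast
    then show ?thesis
      using h_in[OF x, of 1] by (simp add: geom_realization_def)
  qed
  have r_fix: "h 1 x = x" if "x \<in> ?Y" for x
  proof (rule h_fix)
    have "\<not> e \<subseteq> {v. x v \<noteq> 0}"
      using that by (simp add: geom_realization_def)
    then obtain u where "u \<in> e" "x u = 0"
      by blast
    then have "t x \<le> 0"
      using t_le by metis
    moreover obtain u' where "t x = x u'"
      using t_attained by blast
    ultimately show "t x = 0"
      using that by (simp add: geom_realization_def antisym)
  qed
  have Y_sub: "?Y \<subseteq> ?X"
    by (auto simp: geom_realization_def)
  have cont: "continuous_on S (\<lambda>p. h (fst p) (snd p))" for S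
  proof (rule continuous_on_coordinatewise_then_product)
    fix v
    have "continuous_on S (\<lambda>p. x (snd p))" if "continuous_on UNIV x"
      for x :: "('a \<Rightarrow> real) \<Rightarrow> real"
      using that by (intro continuous_on_compose2[OF that] continuous_intros) auto
    from this[OF continuous_on_coordinate] this[OF continuous_on_Min_coordinates[OF fe e(1)]]
    show "continuous_on S (\<lambda>p. h (fst p) (snd p) v)"
      unfolding h_def t_def by (intro continuous_intros)
  qed
  have "homotopic_with (\<lambda>x. True) (top_of_set ?X) (top_of_set ?X) id (h 1)"
    unfolding homotopic_with_def
  proof (intro exI conjI)
    show "continuous_map (prod_topology (top_of_set {0..1}) (top_of_set ?X)) (top_of_set ?X)
            (\<lambda>p. h (fst p) (snd p))"
      using cont h_in by (auto simp: continuous_map_subtopology_eu)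
  qed (auto simp: h_def)
  then have hom: "homotopic_with (\<lambda>x. True) (top_of_set ?X) (top_of_set ?X) (h 1) id"
    by (rule homotopic_with_symD)
  have "continuous_on ?X (h 1)"
    using continuous_on_compose2[OF cont[of UNIV], of ?X "\<lambda>x. (1, x)"]
    by (simp add: continuous_on_Pair continuous_on_id)
  then have "retraction_maps (top_of_set ?X) (top_of_set ?Y) (h 1) id"
    using r_in r_fix Y_sub
    by (auto simp: retraction_maps_def continuous_map_subtopology_eu)
  with hom show ?thesis
    by (rule deformation_retract_imp_homotopy_equivalent_space)
qed

text \<open>One member of \<open>E\<close> is deleted at a time. Since the common \<open>w\<close>
  lies in no member of \<open>E\<close>, adding it to a face cannot complete a set deleted earlier,
  so the cone condition survives.\<close>

lemma homotopy_eqv_delete_faces: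
  assumes V: "finite V" "K \<subseteq> Pow V"
    and down: "\<And>\<sigma> \<tau>. \<sigma> \<in> K \<Longrightarrow> \<tau> \<subseteq> \<sigma> \<Longrightarrow> \<tau> \<in> K"
    and E: "E \<subseteq> Pow V" "{} \<notin> E" and w: "w \<in> V" "w \<notin> \<Union>E"
    and cone: "\<And>\<sigma> e. \<sigma> \<in> K \<Longrightarrow> e \<in> E \<Longrightarrow> e \<subseteq> \<sigma> \<Longrightarrow> insert w \<sigma> \<in> K"
  shows "geom_realization V K homotopy_eqv geom_realization V {\<sigma> \<in> K. \<forall>e\<in>E. \<not> e \<subseteq> \<sigma>}"
proof -
  have "finite E"
    using V E by (meson finite_Pow_iff finite_subset)
  then show ?thesis
    using E w cone
  proof (induction rule: finite_induct)
    case empty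
    then show ?case by (simp add: homotopy_equivalent_space_refl)
  next
    case (insert e E)
    let ?K = "{\<sigma> \<in> K. \<forall>e\<in>E. \<not> e \<subseteq> \<sigma>}"
    have "geom_realization V K homotopy_eqv geom_realization V ?K"
      by (rule insert.IH) (use insert.prems in auto)
    also have "geom_realization V ?K homotopy_eqv geom_realization V {\<sigma> \<in> ?K. \<not> e \<subseteq> \<sigma>}"
    proof (rule homotopy_eqv_delete_face)
      show "\<tau> \<in> ?K" if "\<sigma> \<in> ?K" "\<tau> \<subseteq> \<sigma>" for \<sigma> \<tau>
        using that down[of \<sigma> \<tau>] by blast
      show "Set.insert w \<sigma> \<in> ?K" if "\<sigma> \<in> ?K" "e \<subseteq> \<sigma>" for \<sigma>
        using that insert.prems by (auto simp: subset_insert)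
    qed (use V insert.prems in auto)
    also have "{\<sigma> \<in> ?K. \<not> e \<subseteq> \<sigma>} = {\<sigma> \<in> K. \<forall>e'\<in>insert e E. \<not> e' \<subseteq> \<sigma>}"
      by auto
    finally show ?case .
  qed
qed

text \<open>Members of \<open>F\<close> may stick out of \<open>V\<close>, so the same family serves
  after vertices have been deleted.\<close>

definition avoid_complex :: "'a set \<Rightarrow> 'a set set \<Rightarrow> 'a set set" where
  "avoid_complex V F = {\<sigma>. \<sigma> \<subseteq> V \<and> (\<exists>A\<in>F. \<sigma> \<inter> A = {})}"

text \<open>In the link of \<open>x\<close>, the vertices of \<open>B1\<close> and \<open>B2\<close> are dominated by \<open>w1\<close> and
  \<open>w2\<close>; once they are gone, the link is a cone with apex \<open>c\<close>.\<close>

lemma homotopy_eqv_delete_vertex: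
  assumes W: "finite W" "B1 \<subseteq> W" "B2 \<subseteq> W" "x \<in> W" "c \<in> W" "w1 \<in> W" "w2 \<in> W"
    and notin: "w1 \<notin> insert x B1" "w2 \<notin> insert x (B1 \<union> B2)" "c \<notin> insert x (B1 \<union> B2)"
    and dom1: "\<And>A. A \<in> F \<Longrightarrow> x \<notin> A \<Longrightarrow> w1 \<in> A \<Longrightarrow> B1 \<subseteq> A"
    and dom2: "\<And>A. A \<in> F \<Longrightarrow> x \<notin> A \<Longrightarrow> w2 \<in> A \<Longrightarrow> B2 \<subseteq> A"
    and apex: "\<And>A. A \<in> F \<Longrightarrow> x \<notin> A \<Longrightarrow> c \<in> A
                 \<Longrightarrow> \<exists>A'\<in>F. x \<notin> A' \<and> c \<notin> A' \<and> A' \<inter> W \<subseteq> A \<union> B1 \<union> B2"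
  shows "geom_realization W (avoid_complex W F)
           homotopy_eqv geom_realization (W - {x}) (avoid_complex (W - {x}) F)"
proof -
  let ?K = "avoid_complex W F"
  define K1 where "K1 = {\<sigma> \<in> ?K. \<forall>e\<in>(\<lambda>b. {x, b}) ` B1. \<not> e \<subseteq> \<sigma>}"
  define K2 where "K2 = {\<sigma> \<in> K1. \<forall>e\<in>(\<lambda>b. {x, b}) ` B2. \<not> e \<subseteq> \<sigma>}"
  have down: "\<tau> \<in> ?K" if "\<sigma> \<in> ?K" "\<tau> \<subseteq> \<sigma>" for \<sigma> \<tau>
    using that unfolding avoid_complex_def by blast
  have K1_iff: "\<sigma> \<in> K1 \<longleftrightarrow> \<sigma> \<in> ?K \<and> (x \<in> \<sigma> \<longrightarrow> \<sigma> \<inter> B1 = {})" for \<sigma>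
    by (auto simp: K1_def)
  have K2_iff: "\<sigma> \<in> K2 \<longleftrightarrow> \<sigma> \<in> ?K \<and> (x \<in> \<sigma> \<longrightarrow> \<sigma> \<inter> (B1 \<union> B2) = {})" for \<sigma>
    by (auto simp: K2_def K1_iff)
  have K12: "K1 \<subseteq> Pow W" "K2 \<subseteq> Pow W"
    by (auto simp: avoid_complex_def K1_iff K2_iff)
  have 1: "geom_realization W ?K homotopy_eqv geom_realization W K1"
    unfolding K1_def
  proof (rule homotopy_eqv_delete_faces[where w = w1])
    show "insert w1 \<sigma> \<in> ?K" if \<sigma>: "\<sigma> \<in> ?K" "e \<in> (\<lambda>b. {x, b}) ` B1" "e \<subseteq> \<sigma>" for \<sigma> e
    proof -
      obtain A where A: "A \<in> F" "\<sigma> \<inter> A = {}"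
        using \<sigma> by (auto simp: avoid_complex_def)
      \<comment> \<open>The face contains \<open>x\<close> and some \<open>b \<in> B1\<close>; a
        missed set through \<open>w1\<close> would contain that \<open>b\<close> too.\<close>
      then have "w1 \<notin> A"
        using dom1[OF A(1)] \<sigma> by blast
      then show ?thesis
        using A \<sigma> W by (auto simp: avoid_complex_def)
    qed
    show "\<tau> \<in> ?K" if "\<sigma> \<in> ?K" "\<tau> \<subseteq> \<sigma>" for \<sigma> \<tau>
      using that by (rule down)
  qed (use W notin in \<open>auto simp: avoid_complex_def\<close>)
  have 2: "geom_realization W K1 homotopy_eqv geom_realization W K2"
    unfolding K2_def
  proof (rule homotopy_eqv_delete_faces[where w = w2])
    \<comment> \<open>Besides domination, \<open>w2 \<notin> B1\<close> matters: adding
      \<open>w2\<close> must not bring back an edge from \<open>x\<close> to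
      \<open>B1\<close>.\<close>
    show "insert w2 \<sigma> \<in> K1" if \<sigma>: "\<sigma> \<in> K1" "e \<in> (\<lambda>b. {x, b}) ` B2" "e \<subseteq> \<sigma>" for \<sigma> e
    proof -
      obtain A where A: "A \<in> F" "\<sigma> \<inter> A = {}"
        using \<sigma> by (auto simp: avoid_complex_def K1_iff)
      then have "w2 \<notin> A"
        using dom2[OF A(1)] \<sigma> by blast
      then show ?thesis
        using A \<sigma> W notin by (auto simp: avoid_complex_def K1_iff)
    qed
    show "\<tau> \<in> K1" if "\<sigma> \<in> K1" "\<tau> \<subseteq> \<sigma>" for \<sigma> \<tau>
      using that down[of \<sigma> \<tau>] unfolding K1_iff by blast
  qed (use W notin K12 in auto)
  have 3: "geom_realization W K2 homotopy_eqv geom_realization W {\<sigma> \<in> K2. \<forall>e\<in>{{x}}. \<not> e \<subseteq> \<sigma>}"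
  proof (rule homotopy_eqv_delete_faces[where w = c])
    show "insert c \<sigma> \<in> K2" if \<sigma>: "\<sigma> \<in> K2" "e \<in> {{x}}" "e \<subseteq> \<sigma>" for \<sigma> e
    proof -
      have B: "\<sigma> \<inter> (B1 \<union> B2) = {}" "x \<in> \<sigma>" "\<sigma> \<subseteq> W"
        using \<sigma> by (auto simp: avoid_complex_def K2_iff)
      obtain A where A: "A \<in> F" "\<sigma> \<inter> A = {}"
        using \<sigma> by (auto simp: avoid_complex_def K2_iff)
      \<comment> \<open>If the missed set contains \<open>c\<close>, exchange it for the
        \<open>A'\<close> of \<open>apex\<close>: within \<open>W\<close>, all that
        \<open>A'\<close> has beyond \<open>A\<close> lies in \<open>B1 \<union> B2\<close>, which
        \<open>\<sigma>\<close> already misses.\<close>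
      have "\<exists>A'\<in>F. insert c \<sigma> \<inter> A' = {}"
      proof (cases "c \<in> A")
        case True
        then obtain A' where "A' \<in> F" "c \<notin> A'" "A' \<inter> W \<subseteq> A \<union> B1 \<union> B2"
          using apex[of A] A B by blast
        then show ?thesis
          using A B by blast
      qed (use A in auto)
      then show ?thesis
        using B W notin by (auto simp: avoid_complex_def K2_iff)
    qed
    show "\<tau> \<in> K2" if "\<sigma> \<in> K2" "\<tau> \<subseteq> \<sigma>" for \<sigma> \<tau>
      using that down[of \<sigma> \<tau>] unfolding K2_iff by blast
  qed (use W notin K12 in auto)
  have K3: "{\<sigma> \<in> K2. \<forall>e\<in>{{x}}. \<not> e \<subseteq> \<sigma>} = avoid_complex (W - {x}) F"
    by (auto simp: avoid_complex_def K2_iff)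
  have "geom_realization W (avoid_complex (W - {x}) F)
      = geom_realization (W - {x}) (avoid_complex (W - {x}) F)"
    using W by (intro geom_realization_cong) (auto simp: avoid_complex_def)
  with homotopy_eqv_trans[OF 1 homotopy_eqv_trans[OF 2 3]] K3 show ?thesis
    by simp
qed

section \<open>Relabelling of vertices\<close>

lemma homeomorphic_geom_realization_relabel:
  assumes "finite V" and bij: "bij_betw \<phi> V V'" and K: "K \<subseteq> Pow V"
  shows "geom_realization V K homeomorphic geom_realization V' ((`) \<phi> ` K)"
proof -
  define \<psi> where "\<psi> = inv_into V \<phi>"
  have \<psi>: "bij_betw \<psi> V' V" "\<And>v. v \<in> V \<Longrightarrow> \<psi> (\<phi> v) = v" "\<And>v. v \<in> V' \<Longrightarrow> \<phi> (\<psi> v) = v"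
    using bij bij_betw_inv_into bij_betw_inv_into_left bij_betw_inv_into_right
    unfolding \<psi>_def by metis+
  \<comment> \<open>Points are functions on the whole type, supported on the vertex set; hence the
    default 0 outside \<open>V'\<close>, and likewise outside \<open>V\<close> for
    \<open>g\<close>.\<close>
  define f where "f x v = (if v \<in> V' then x (\<psi> v) else 0)" for x :: "'a \<Rightarrow> real" and v
  define g where "g y v = (if v \<in> V then y (\<phi> v) else 0)" for y :: "'b \<Rightarrow> real" and v
  have V: "\<phi> v \<in> V'" if "v \<in> V" for v
    using that bij bij_betwE by blast
  have V': "\<psi> v \<in> V" if "v \<in> V'" for v
    using that \<psi>(1) bij_betwE by blast
  have f_supp: "{v. f x v \<noteq> 0} = \<phi> ` {v. x v \<noteq> 0}" if "{v. x v \<noteq> 0} \<subseteq> V" for x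
  proof (intro equalityI subsetI)
    fix v assume "v \<in> {v. f x v \<noteq> 0}"
    then have "v \<in> V'" "x (\<psi> v) \<noteq> 0"
      by (auto simp: f_def split: if_splits)
    then show "v \<in> \<phi> ` {v. x v \<noteq> 0}"
      using \<psi>(3) by (intro image_eqI[of _ _ "\<psi> v"]) auto
  next
    fix v assume "v \<in> \<phi> ` {v. x v \<noteq> 0}"
    then obtain u where "v = \<phi> u" "x u \<noteq> 0"
      by blast
    then show "v \<in> {v. f x v \<noteq> 0}"
      using that V \<psi>(2) by (auto simp: f_def)
  qed
  have g_supp: "{v. g y v \<noteq> 0} = {v \<in> V. y (\<phi> v) \<noteq> 0}" for y
    by (auto simp: g_def)
  have f_sum: "sum (f x) V' = sum x V" for x
    using sum.reindex_bij_betw[OF \<psi>(1), of x] by (simp add: f_def cong: sum.cong)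
  have g_sum: "sum (g y) V = sum y V'" for y
    using sum.reindex_bij_betw[OF bij, of y] by (simp add: g_def cong: sum.cong)
  have "homeomorphism (geom_realization V K) (geom_realization V' ((`) \<phi> ` K)) f g"
  proof (rule homeomorphismI)
    have "continuous_on S (\<lambda>x. f x v)" for S v
      unfolding f_def by (cases "v \<in> V'") (simp_all add: continuous_on_coordinate)
    then show "continuous_on (geom_realization V K) f"
      by (rule continuous_on_coordinatewise_then_product)
    have "continuous_on S (\<lambda>y. g y v)" for S v
      unfolding g_def by (cases "v \<in> V") (simp_all add: continuous_on_coordinate)
    then show "continuous_on (geom_realization V' ((`) \<phi> ` K)) g"
      by (rule continuous_on_coordinatewise_then_product)
    show "f ` geom_realization V K \<subseteq> geom_realization V' ((`) \<phi> ` K)"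
    proof (rule image_subsetI)
      fix x assume x: "x \<in> geom_realization V K"
      then have "{v. f x v \<noteq> 0} = \<phi> ` {v. x v \<noteq> 0}"
        by (intro f_supp) (simp add: geom_realization_def)
      with x f_sum[of x] V show "f x \<in> geom_realization V' ((`) \<phi> ` K)"
        unfolding geom_realization_def by (auto simp: f_def)
    qed
    show "g ` geom_realization V' ((`) \<phi> ` K) \<subseteq> geom_realization V K"
    proof (rule image_subsetI)
      fix y assume y: "y \<in> geom_realization V' ((`) \<phi> ` K)"
      then obtain \<sigma> where \<sigma>: "\<sigma> \<in> K" "{v. y v \<noteq> 0} = \<phi> ` \<sigma>"
        by (auto simp: geom_realization_def)
      have "\<sigma> \<subseteq> V"
        using \<sigma> K by blast
      have "{v. g y v \<noteq> 0} = {v \<in> V. \<phi> v \<in> \<phi> ` \<sigma>}"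
        unfolding g_supp using \<sigma>(2) by auto
      also have "\<dots> = \<sigma>"
        using \<open>\<sigma> \<subseteq> V\<close> \<psi>(2) by (auto simp: image_iff) (metis subsetD)
      finally show "g y \<in> geom_realization V K"
        using y \<sigma>(1) \<open>\<sigma> \<subseteq> V\<close> g_sum[of y] unfolding geom_realization_def by (auto simp: g_def)
    qed
    show "g (f x) = x" if "x \<in> geom_realization V K" for x
      using that V \<psi> by (auto simp: f_def g_def fun_eq_iff geom_realization_def)
    show "f (g y) = y" if "y \<in> geom_realization V' ((`) \<phi> ` K)" for y
      using that V' \<psi> by (auto simp: f_def g_def fun_eq_iff geom_realization_def)
  qed
  then show ?thesis
    unfolding homeomorphic_def by blast
qed

text \<open>A set that misses \<open>A\<close> misses everything smaller, so only the minimal traces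
  on the vertex set count. The families need not correspond one to one: each member only needs a
  member of the other family with a smaller trace.\<close>

lemma homeomorphic_avoid_complex:
  assumes "finite V" and bij: "bij_betw \<phi> V V'"
    and F: "\<And>A. A \<in> F \<Longrightarrow> \<exists>A'\<in>F'. A' \<inter> V' \<subseteq> \<phi> ` (A \<inter> V)"
    and F': "\<And>A'. A' \<in> F' \<Longrightarrow> \<exists>A\<in>F. \<phi> ` (A \<inter> V) \<subseteq> A'"
  shows "geom_realization V (avoid_complex V F) homeomorphic
         geom_realization V' (avoid_complex V' F')"
proof -
  have inj: "inj_on \<phi> V" and im: "\<phi> ` V = V'"
    using bij by (auto simp: bij_betw_def)
  have "(`) \<phi> ` avoid_complex V F = avoid_complex V' F'"
  proof (intro equalityI subsetI)
    fix \<tau> assume "\<tau> \<in> (`) \<phi> ` avoid_complex V F"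
    then obtain \<sigma> A where \<sigma>: "\<tau> = \<phi> ` \<sigma>" "\<sigma> \<subseteq> V" "A \<in> F" "\<sigma> \<inter> A = {}"
      by (auto simp: avoid_complex_def)
    obtain A' where A': "A' \<in> F'" "A' \<inter> V' \<subseteq> \<phi> ` (A \<inter> V)"
      using F \<sigma> by blast
    have "\<phi> ` \<sigma> \<inter> \<phi> ` (A \<inter> V) = \<phi> ` (\<sigma> \<inter> (A \<inter> V))"
      using inj \<sigma> by (intro inj_on_image_Int[symmetric]) auto
    then have "\<tau> \<inter> A' = {}"
      using \<sigma> A' im by blast
    then show "\<tau> \<in> avoid_complex V' F'"
      using \<sigma> A' im by (auto simp: avoid_complex_def)
  next
    fix \<tau> assume "\<tau> \<in> avoid_complex V' F'"
    then obtain A' where A': "\<tau> \<subseteq> V'" "A' \<in> F'" "\<tau> \<inter> A' = {}"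
      by (auto simp: avoid_complex_def)
    then obtain A where A: "A \<in> F" "\<phi> ` (A \<inter> V) \<subseteq> A'"
      using F' by blast
    have "{v \<in> V. \<phi> v \<in> \<tau>} \<inter> A = {}"
      using A A' by blast
    then have "{v \<in> V. \<phi> v \<in> \<tau>} \<in> avoid_complex V F"
      using A by (auto simp: avoid_complex_def)
    moreover have "\<tau> = \<phi> ` {v \<in> V. \<phi> v \<in> \<tau>}"
      using A' im by auto
    ultimately show "\<tau> \<in> (`) \<phi> ` avoid_complex V F"
      by blast
  qed
  then show ?thesis
    using homeomorphic_geom_realization_relabel[OF assms(1,2), of "avoid_complex V F"]
    by (auto simp: avoid_complex_def)
qed

section \<open>The boundary of a simplex\<close>

text \<open>One vertex \<open>p\<close> goes to the origin and the others to the basis vectors. This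
  identifies the boundary with the frontier of the standard simplex, and relative frontiers of
  bounded convex sets of equal dimension are homeomorphic.\<close>

lemma simplex_boundary_homeomorphic_sphere:
  assumes W: "finite W" "card W = DIM('n) + 1"
  shows "geom_realization W {\<sigma>. \<sigma> \<subset> W} homeomorphic sphere (0 :: 'n::euclidean_space) 1"
proof -
  have "W \<noteq> {}"
    using W by force
  then obtain p where p: "p \<in> W"
    by blast
  have "card (Basis :: 'n set) = card (W - {p})"
    using W p by simp
  then obtain \<beta> where \<beta>: "bij_betw \<beta> (Basis :: 'n set) (W - {p})"
    using finite_same_card_bij[of Basis "W - {p}"] W by auto
  define \<gamma> where "\<gamma> = inv_into Basis \<beta>"
  have \<gamma>: "bij_betw \<gamma> (W - {p}) Basis" "\<And>b. b \<in> Basis \<Longrightarrow> \<gamma> (\<beta> b) = b"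
      "\<And>v. v \<in> W - {p} \<Longrightarrow> \<beta> (\<gamma> v) = v"
    using \<beta> bij_betw_inv_into bij_betw_inv_into_left bij_betw_inv_into_right
    unfolding \<gamma>_def by metis+
  have \<beta>_in: "\<beta> b \<in> W" "\<beta> b \<noteq> p" if "b \<in> Basis" for b
    using that \<beta> bij_betwE by blast+
  have \<gamma>_in: "\<gamma> v \<in> Basis" if "v \<in> W" "v \<noteq> p" for v
    using that \<gamma>(1) bij_betwE by blast
  define f :: "('a \<Rightarrow> real) \<Rightarrow> 'n" where "f x = (\<Sum>b\<in>Basis. x (\<beta> b) *\<^sub>R b)" for x
  \<comment> \<open>The coordinate at \<open>p\<close> is the slack that brings the sum up to
    1.\<close>
  define g where "g y v = (if v = p then 1 - (\<Sum>b\<in>Basis. y \<bullet> b) else if v \<in> W then y \<bullet> \<gamma> v else 0)"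
    for y :: 'n and v
  let ?S = "convex hull (insert 0 Basis) :: 'n set"
  have int: "interior ?S \<noteq> {}"
    using interior_std_simplex_nonempty by blast
  have comp: "compact ?S"
    by (simp add: compact_convex_hull finite_imp_compact)
  have "frontier ?S = ?S - interior ?S"
    using comp by (simp add: frontier_def compact_imp_closed)
  with rel_frontier_nonempty_interior[OF int]
  have rf_diff: "rel_frontier ?S = ?S - interior ?S"
    by metis
  \<comment> \<open>A point of the simplex is on the frontier when a barycentric coordinate
    vanishes; the slack at the origin counts as one of them.\<close>
  have rf: "rel_frontier ?S = {y. (\<forall>b\<in>Basis. 0 \<le> y \<bullet> b) \<and> (\<Sum>b\<in>Basis. y \<bullet> b) \<le> 1 \<and>
      ((\<exists>b\<in>Basis. y \<bullet> b = 0) \<or> (\<Sum>b\<in>Basis. y \<bullet> b) = 1)}"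
    unfolding rf_diff interior_std_simplex unfolding std_simplex by (auto simp: less_le)
  have gr: "geom_realization W {\<sigma>. \<sigma> \<subset> W} =
      {x. (\<forall>v. 0 \<le> x v) \<and> {v. x v \<noteq> 0} \<subseteq> W \<and> sum x W = 1 \<and> (\<exists>v\<in>W. x v = 0)}"
    by (auto simp: geom_realization_def)
  have f_inner: "f x \<bullet> b = x (\<beta> b)" if "b \<in> Basis" for x b
    using that by (simp add: f_def inner_sum_left inner_Basis if_distrib cong: if_cong)
  have f_sum: "(\<Sum>b\<in>Basis. x (\<beta> b)) = sum x W - x p" for x :: "'a \<Rightarrow> real"
    using sum.reindex_bij_betw[OF \<beta>, of x] W p by (simp add: sum_diff1)
  have g_sum: "sum (g y) W = 1" for y
  proof -
    have "sum (g y) (W - {p}) = (\<Sum>v\<in>W - {p}. y \<bullet> \<gamma> v)"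
      by (intro sum.cong) (auto simp: g_def)
    also have "\<dots> = (\<Sum>b\<in>Basis. y \<bullet> b)"
      using sum.reindex_bij_betw[OF \<gamma>(1), of "\<lambda>b. y \<bullet> b"] .
    finally show ?thesis
      using W p by (simp add: sum.remove[of W p] g_def)
  qed
  have "homeomorphism (geom_realization W {\<sigma>. \<sigma> \<subset> W}) (rel_frontier ?S) f g"
  proof (rule homeomorphismI)
    show "continuous_on (geom_realization W {\<sigma>. \<sigma> \<subset> W}) f"
      unfolding f_def by (intro continuous_intros continuous_on_coordinate)
    have "continuous_on S (\<lambda>y. g y v)" for S v
      unfolding g_def by (cases "v = p"; cases "v \<in> W") (simp_all add: continuous_intros)
    then show "continuous_on (rel_frontier ?S) g"
      by (rule continuous_on_coordinatewise_then_product)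
    show "f ` geom_realization W {\<sigma>. \<sigma> \<subset> W} \<subseteq> rel_frontier ?S"
    proof (rule image_subsetI)
      fix x assume x: "x \<in> geom_realization W {\<sigma>. \<sigma> \<subset> W}"
      then obtain v where v: "v \<in> W" "x v = 0"
        by (auto simp: gr)
      have "(\<exists>b\<in>Basis. x (\<beta> b) = 0) \<or> x p = 0"
        using v \<gamma>(3)[of v] \<gamma>_in[of v] by (cases "v = p") force+
      then show "f x \<in> rel_frontier ?S"
        using x by (auto simp: gr rf f_inner f_sum)
    qed
    show "g ` rel_frontier ?S \<subseteq> geom_realization W {\<sigma>. \<sigma> \<subset> W}"
    proof (rule image_subsetI)
      fix y assume y: "y \<in> rel_frontier ?S"
      have "\<exists>v\<in>W. g y v = 0"
      proof (cases "(\<Sum>b\<in>Basis. y \<bullet> b) = 1")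
        case True
        then show ?thesis using p by (auto simp: g_def)
      next
        case False
        then obtain b where "b \<in> Basis" "y \<bullet> b = 0"
          using y by (auto simp: rf)
        then have "g y (\<beta> b) = 0"
          using \<beta>_in \<gamma> by (auto simp: g_def)
        then show ?thesis using \<beta>_in \<open>b \<in> Basis\<close> by blast
      qed
      moreover have "{v. g y v \<noteq> 0} \<subseteq> W"
        using p by (auto simp: g_def split: if_splits)
      moreover have "\<forall>v. 0 \<le> g y v"
        using y \<gamma>_in by (auto simp: g_def rf)
      ultimately show "g y \<in> geom_realization W {\<sigma>. \<sigma> \<subset> W}"
        using g_sum by (simp add: gr)
    qed
    show "g (f x) = x" if x: "x \<in> geom_realization W {\<sigma>. \<sigma> \<subset> W}" for x
    proof
      fix v
      show "g (f x) v = x v"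
        using x \<gamma>_in[of v] \<gamma>(3)[of v] by (auto simp: g_def gr f_inner f_sum)
    qed
    show "f (g y) = y" if "y \<in> rel_frontier ?S" for y
    proof (rule euclidean_eqI)
      fix b :: 'n assume "b \<in> Basis"
      then show "f (g y) \<bullet> b = y \<bullet> b"
        using \<beta>_in \<gamma>(2) by (simp add: f_inner g_def)
    qed
  qed
  then have 1: "geom_realization W {\<sigma>. \<sigma> \<subset> W} homeomorphic rel_frontier ?S"
    unfolding homeomorphic_def by blast
  have "aff_dim ?S = aff_dim (cball (0::'n) 1)"
    using aff_dim_nonempty_interior[OF int] aff_dim_cball[of 1 "0::'n"] by simp
  then have "rel_frontier ?S homeomorphic rel_frontier (cball (0::'n) 1)"
    by (intro homeomorphic_rel_frontiers_convex_bounded_sets convex_convex_hull convex_cball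
          compact_imp_bounded[OF comp] bounded_cball)
  with 1 have "geom_realization W {\<sigma>. \<sigma> \<subset> W} homeomorphic rel_frontier (cball (0::'n) 1)"
    by (rule homeomorphic_trans)
  then show ?thesis
    by (simp add: rel_frontier_cball)
qed

section \<open>Sets missing a cyclic arc\<close>

text \<open>Arcs of length \<open>k\<close> in the cyclic order on \<open>0, \<dots>, 3 k\<close>; the second family wraps around.\<close>

definition cyclic_arcs :: "nat \<Rightarrow> nat set set" where
  "cyclic_arcs k = (\<lambda>a. {a..<a + k}) ` {..2*k+1} \<union> (\<lambda>a. {..<a} \<union> {2*k+1+a..<3*k+1}) ` {..<k}"

lemma cyclic_arcsE [consumes 1, case_names inner outer]:
  assumes "A \<in> cyclic_arcs k"
  obtains a where "a \<le> 2*k+1" "A = {a..<a+k}"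
  | a where "a < k" "A = {..<a} \<union> {2*k+1+a..<3*k+1}"
  using assms unfolding cyclic_arcs_def by auto

lemma inner_arc: "a \<le> 2*k+1 \<Longrightarrow> {a..<a+k} \<in> cyclic_arcs k"
  unfolding cyclic_arcs_def by blast

lemma outer_arc: "a < k \<Longrightarrow> {..<a} \<union> {2*k+1+a..<3*k+1} \<in> cyclic_arcs k"
  unfolding cyclic_arcs_def by blast

abbreviation arc_realization :: "nat set \<Rightarrow> nat \<Rightarrow> (nat \<Rightarrow> real) set" where
  "arc_realization W k \<equiv> geom_realization W (avoid_complex W (cyclic_arcs k))"

section \<open>The reduction from \<open>k\<close> to \<open>k - 1\<close>\<close>

text \<open>The only arc through 1 that avoids 0 is \<open>{1..k}\<close>, and the only one through
  \<open>3*k\<close> is \<open>{2*k+1..3*k}\<close>. This gives \<open>B1\<close> and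
  \<open>B2\<close>.\<close>

lemma delete_first_vertex:
  assumes k: "k \<ge> 3"
  shows "arc_realization {..<3*k+1} k homotopy_eqv arc_realization ({..<3*k+1} - {0}) k"
proof (rule homotopy_eqv_delete_vertex
    [where ?B1.0 = "{2..k}" and ?w1.0 = 1 and ?B2.0 = "{2*k+1..<3*k}" and ?w2.0 = "3*k" and c = "k+2"])
  show "{2..k} \<subseteq> A" if "A \<in> cyclic_arcs k" "0 \<notin> A" "1 \<in> A" for A
    using that by (cases rule: cyclic_arcsE) auto
  show "{2*k+1..<3*k} \<subseteq> A" if "A \<in> cyclic_arcs k" "0 \<notin> A" "3*k \<in> A" for A
    using that by (cases rule: cyclic_arcsE) auto
  show "\<exists>A'\<in>cyclic_arcs k. 0 \<notin> A' \<and> k+2 \<notin> A' \<and>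
          A' \<inter> {..<3*k+1} \<subseteq> A \<union> {2..k} \<union> {2*k+1..<3*k}"
    if A: "A \<in> cyclic_arcs k" "0 \<notin> A" "k+2 \<in> A" for A
    using A
  proof (cases rule: cyclic_arcsE)
    case (inner a)
    show ?thesis
    \<comment> \<open>An arc starting at \<open>k+2\<close> contains \<open>2*k\<close>, so
      \<open>{2*k..<3*k}\<close> replaces it. Any other arc considered here contains
      \<open>k+1\<close>, so \<open>{2..k+1}\<close> does. Neither replacement contains
      \<open>k+2\<close>, because \<open>k \<ge> 3\<close>.\<close>
    proof (cases "a = k+2")
      case True
      then have "{2*k..<2*k+k} \<inter> {..<3*k+1} \<subseteq> A \<union> {2..k} \<union> {2*k+1..<3*k}"
        using k inner by auto
      then show ?thesis
        using k by (intro bexI[OF _ inner_arc[of "2*k"]]) auto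
    next
      case False
      then have "{2..<2+k} \<inter> {..<3*k+1} \<subseteq> A \<union> {2..k} \<union> {2*k+1..<3*k}"
        using k inner A by auto
      then show ?thesis
        using k by (intro bexI[OF _ inner_arc[of 2]]) auto
    qed
  next
    case (outer a)
    with A k show ?thesis by auto
  qed
qed (use k in auto)

text \<open>The only arc through \<open>k+1\<close> that avoids \<open>k\<close> is
  \<open>{k+1..2*k}\<close>, and the only one through \<open>k-1\<close> is \<open>{..<k}\<close>.
  The arcs that replace those through the apex may contain 0, which is already gone.\<close>

lemma delete_second_vertex:
  assumes k: "k \<ge> 3"
  shows "arc_realization ({..<3*k+1} - {0}) k homotopy_eqv
         arc_realization ({..<3*k+1} - {0} - {k}) k"
proof (rule homotopy_eqv_delete_vertex
    [where ?B1.0 = "{k+2..2*k}" and ?w1.0 = "k+1" and ?B2.0 = "{1..<k-1}" and ?w2.0 = "k-1"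
       and c = "2*k+2"])
  show "{k+2..2*k} \<subseteq> A" if "A \<in> cyclic_arcs k" "k \<notin> A" "k+1 \<in> A" for A
    using that by (cases rule: cyclic_arcsE) auto
  show "{1..<k-1} \<subseteq> A" if "A \<in> cyclic_arcs k" "k \<notin> A" "k-1 \<in> A" for A
    using that k by (cases rule: cyclic_arcsE) auto
  show "\<exists>A'\<in>cyclic_arcs k. k \<notin> A' \<and> 2*k+2 \<notin> A' \<and>
          A' \<inter> ({..<3*k+1} - {0}) \<subseteq> A \<union> {k+2..2*k} \<union> {1..<k-1}"
    if A: "A \<in> cyclic_arcs k" "k \<notin> A" "2*k+2 \<in> A" for A
  proof (cases "2*k+1 \<in> A")
    case True
    have "{k+2..<k+2+k} \<inter> ({..<3*k+1} - {0}) \<subseteq> insert (2*k+1) {k+2..2*k}"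
      by auto
    with True have "{k+2..<k+2+k} \<inter> ({..<3*k+1} - {0}) \<subseteq> A \<union> {k+2..2*k} \<union> {1..<k-1}"
      by blast
    then show ?thesis
      using k by (intro bexI[OF _ inner_arc[of "k+2"]]) auto
  next
    case False
    \<comment> \<open>An arc through \<open>2*k+2\<close> but not \<open>2*k+1\<close> starts at
      \<open>2*k+2\<close>, so it runs past \<open>3*k\<close> and ends at 0.\<close>
    have last: "3*k \<in> A"
      using A(1)
    proof (cases rule: cyclic_arcsE)
      case (inner a)
      with A False k show ?thesis by auto
    next
      case (outer a)
      with A False k show ?thesis by auto
    qed
    have "({..<k-1} \<union> {2*k+1+(k-1)..<3*k+1}) \<inter> ({..<3*k+1} - {0})
        \<subseteq> insert (3*k) {1..<k-1}"
      using k by auto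
    with last have "({..<k-1} \<union> {2*k+1+(k-1)..<3*k+1}) \<inter> ({..<3*k+1} - {0})
        \<subseteq> A \<union> {k+2..2*k} \<union> {1..<k-1}"
      by blast
    then show ?thesis
      using k by (intro bexI[OF _ outer_arc[of "k-1"]]) auto
  qed
qed (use k in auto)

text \<open>No preliminary deletions: the only arc through \<open>2*k+1\<close> that avoids
  \<open>2*k\<close> starts at \<open>2*k+1\<close>. Moving it one step on replaces
  \<open>2*k+1\<close> by the deleted vertex 0, so its trace shrinks.\<close>

lemma delete_third_vertex:
  assumes k: "k \<ge> 3"
  shows "arc_realization ({..<3*k+1} - {0} - {k}) k homotopy_eqv
         arc_realization ({..<3*k+1} - {0} - {k} - {2*k}) k"
proof (rule homotopy_eqv_delete_vertex
    [where ?B1.0 = "{}" and ?w1.0 = "2*k+1" and ?B2.0 = "{}" and ?w2.0 = "2*k+1" and c = "2*k+1"])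
  show "\<exists>A'\<in>cyclic_arcs k. 2*k \<notin> A' \<and> 2*k+1 \<notin> A' \<and>
          A' \<inter> ({..<3*k+1} - {0} - {k}) \<subseteq> A \<union> {} \<union> {}"
    if A: "A \<in> cyclic_arcs k" "2*k \<notin> A" "2*k+1 \<in> A" for A
  proof -
    have "{2*k+1..<3*k+1} \<subseteq> A"
      using A k by (cases rule: cyclic_arcsE) auto
    moreover have "({..<1} \<union> {2*k+1+1..<3*k+1}) \<inter> ({..<3*k+1} - {0} - {k}) \<subseteq> {2*k+1..<3*k+1}"
      by auto
    ultimately have "({..<1} \<union> {2*k+1+1..<3*k+1}) \<inter> ({..<3*k+1} - {0} - {k}) \<subseteq> A \<union> {} \<union> {}"
      by blast
    then show ?thesis
      using k by (intro bexI[OF _ outer_arc[of 1]]) auto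
  qed
qed (use k in auto)

text \<open>An arc of length \<open>m+1\<close> contains exactly one of the deleted vertices 0,
  \<open>m+1\<close>, \<open>2*(m+1)\<close>, so it leaves \<open>m\<close> consecutive survivors.
  The one exception is \<open>{2*m+3..3*m+3}\<close>, which contains none of them and has a
  non-minimal trace.\<close>

lemma relabel_step:
  assumes m: "m \<ge> 1"
  shows "arc_realization {..<3*m+1} m homeomorphic
         arc_realization ({..<3*(m+1)+1} - {0} - {m+1} - {2*(m+1)}) (m+1)"
proof -
  \<comment> \<open>The increasing enumeration of the survivors, with inverse
    \<open>\<theta>\<close>; each deleted vertex passed adds 1 to the shift.\<close>
  define \<psi> where "\<psi> i = (if i < m then i + 1 else if i < 2*m then i + 2 else i + 3)" for i
  define \<theta> where "\<theta> j = (if j < m + 1 then j - 1 else if j < 2*m + 2 then j - 2 else j - 3)" for j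
  let ?V = "{..<3*m+1}" and ?W = "{..<3*(m+1)+1} - {0} - {m+1} - {2*(m+1)}"
  have bij: "bij_betw \<psi> ?V ?W"
    by (rule bij_betwI[where g = \<theta>]) (auto simp: \<psi>_def \<theta>_def split: if_splits)
  have im: "\<psi> ` (S \<inter> ?V) = {j \<in> ?W. \<theta> j \<in> S}" for S
  proof (intro equalityI subsetI)
    fix j assume j: "j \<in> {j \<in> ?W. \<theta> j \<in> S}"
    then have "j = \<psi> (\<theta> j)" "\<theta> j \<in> ?V"
      by (auto simp: \<psi>_def \<theta>_def split: if_splits)
    then show "j \<in> \<psi> ` (S \<inter> ?V)"
      using j by blast
  qed (auto simp: \<psi>_def \<theta>_def split: if_splits)
  show ?thesis
  proof (rule homeomorphic_avoid_complex[OF _ bij])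
    show "\<exists>A'\<in>cyclic_arcs (m+1). A' \<inter> ?W \<subseteq> \<psi> ` (A \<inter> ?V)" if "A \<in> cyclic_arcs m" for A
      using that
    proof (cases rule: cyclic_arcsE)
      case (inner a)
      \<comment> \<open>The start of the longer arc grows with the number of deleted vertices
        passed. The last inner arc becomes a wrapping one, whose extra vertex is the deleted
        0.\<close>
      consider "a = 0" | "0 < a" "a \<le> m" | "m < a" "a \<le> 2*m" | "a = 2*m+1"
        using inner by linarith
      then show ?thesis
      proof cases
        case 1
        then show ?thesis
          using inner by (intro bexI[OF _ inner_arc[of 0]]) (simp_all only: im, auto simp: \<theta>_def split: if_splits)
      next
        case 2
        then show ?thesis
          using inner by (intro bexI[OF _ inner_arc[of "a+1"]]) (simp_all only: im, auto simp: \<theta>_def split: if_splits)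
      next
        case 3
        then show ?thesis
          using inner by (intro bexI[OF _ inner_arc[of "a+2"]]) (simp_all only: im, auto simp: \<theta>_def split: if_splits)
      next
        case 4
        then show ?thesis
          using inner m by (intro bexI[OF _ outer_arc[of 1]]) (simp_all only: im, auto simp: \<theta>_def split: if_splits)
      qed
    next
      case (outer a)
      then show ?thesis
        by (intro bexI[OF _ outer_arc[of "a+1"]]) (simp_all only: im, auto simp: \<theta>_def split: if_splits)
    qed
    show "\<exists>A\<in>cyclic_arcs m. \<psi> ` (A \<inter> ?V) \<subseteq> A'" if "A' \<in> cyclic_arcs (m+1)" for A'
      using that
    proof (cases rule: cyclic_arcsE)
      case (inner a)
      consider "a \<le> 1" | "1 < a" "a \<le> m+2" | "m+2 < a"
        by linarith
      then show ?thesis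
      proof cases
        case 1
        then show ?thesis
          using inner by (intro bexI[OF _ inner_arc[of 0]]) (simp_all only: im, auto simp: \<theta>_def split: if_splits)
      next
        case 2
        show ?thesis
        \<comment> \<open>The arcs starting at \<open>m+1\<close> and at \<open>m+2\<close> have the
          same trace, since \<open>m+1\<close> is deleted.\<close>
        proof (cases "a = m+2")
          case True
          then show ?thesis
            using inner by (intro bexI[OF _ inner_arc[of m]]) (simp_all only: im, auto simp: \<theta>_def split: if_splits)
        next
          case False
          obtain b where "a = b + 1"
            using 2 by (metis less_imp_add_positive add.commute)
          then show ?thesis
            using inner 2 False by (intro bexI[OF _ inner_arc[of b]]) (simp_all only: im, auto simp: \<theta>_def split: if_splits)
        qed
      next
        case 3
        show ?thesis
        \<comment> \<open>This is the exceptional arc with \<open>m+1\<close> survivors; dropping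
          its last element gives the image of an arc of length \<open>m\<close>.\<close>
        proof (cases "a = 2*m+3")
          case True
          then show ?thesis
            using inner by (intro bexI[OF _ inner_arc[of "2*m"]]) (simp_all only: im, auto simp: \<theta>_def split: if_splits)
        next
          case False
          obtain b where "a = b + 2"
            using 3 by (metis le_add_diff_inverse2 le_add2 less_imp_le order.trans)
          then show ?thesis
            using inner 3 False by (intro bexI[OF _ inner_arc[of b]]) (simp_all only: im, auto simp: \<theta>_def split: if_splits)
        qed
      qed
    next
      case (outer a)
      show ?thesis
      \<comment> \<open>For \<open>a = 0\<close> the wrapping family yields the exceptional arc once
        more.\<close>
      proof (cases "a = 0")
        case True
        then show ?thesis
          using outer by (intro bexI[OF _ inner_arc[of "2*m"]]) (simp_all only: im, auto simp: \<theta>_def split: if_splits)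
      next
        case False
        then obtain b where "a = b + 1"
          by (metis Suc_eq_plus1 not0_implies_Suc)
        show ?thesis
        proof (rule bexI[OF _ outer_arc])
          show "\<psi> ` (({..<b} \<union> {2*m+1+b..<3*m+1}) \<inter> ?V) \<subseteq> A'"
            unfolding im
          proof
            fix j assume "j \<in> {j \<in> ?W. \<theta> j \<in> {..<b} \<union> {2*m+1+b..<3*m+1}}"
            then have "j < 3*m+4" "\<theta> j < b \<or> 2*m+1+b \<le> \<theta> j"
              by auto
            then have "j < a \<or> 2*(m+1)+1+a \<le> j"
              using outer(1) \<open>a = b + 1\<close> unfolding \<theta>_def by (auto split: if_splits)
            then show "j \<in> A'"
              unfolding outer(2) using \<open>j < 3*m+4\<close> by auto
          qed
          show "b < m"
            using outer(1) \<open>a = b + 1\<close> by simp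
        qed
      qed
    qed
  qed simp
qed

section \<open>The base case \<open>k = 3\<close>\<close>

lemma cyclic_arcs_3: "cyclic_arcs 3 = {{0,1,2}, {1,2,3}, {2,3,4}, {3,4,5}, {4,5,6}, {5,6,7},
    {6,7,8}, {7,8,9}} \<union> {{7,8,9}, {8,9,0}, {9,0,1}}"
proof -
  have "{..2*3+1::nat} = {0,1,2,3,4,5,6,7}" "{..<3::nat} = {0,1,2}"
    by auto
  moreover have "{0..<0+3} = {0,1,2::nat}" "{1..<1+3} = {1,2,3::nat}" "{2..<2+3} = {2,3,4::nat}"
    "{3..<3+3} = {3,4,5::nat}" "{4..<4+3} = {4,5,6::nat}" "{5..<5+3} = {5,6,7::nat}"
    "{6..<6+3} = {6,7,8::nat}" "{7..<7+3} = {7,8,9::nat}"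
    "{..<0} \<union> {2*3+1+0..<3*3+1} = {7,8,9::nat}" "{..<1} \<union> {2*3+1+1..<3*3+1} = {8,9,0::nat}"
    "{..<2} \<union> {2*3+1+2..<3*3+1} = {9,0,1::nat}"
    by auto
  ultimately show ?thesis
    unfolding cyclic_arcs_def by (simp only: image_insert image_empty)
qed

lemma arc_realization_3:
  "arc_realization {..<3*3+1} 3 homotopy_eqv sphere (0 :: real^4) 1"
proof -
  let ?F = "cyclic_arcs 3"
  have W0: "{..<3*3+1::nat} - {0} = {1,2,3,4,5,6,7,8,9}"
    by auto presburger
  \<comment> \<open>Once 0 is gone, the other even residues have a cone as link at their turn. So
    \<open>B1\<close> and \<open>B2\<close> are empty, and \<open>c\<close> also fills the places of
    \<open>w1\<close> and \<open>w2\<close>.\<close>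
  have step: "arc_realization W 3 homotopy_eqv arc_realization W' 3"
    if "W - {x} = W'" "finite W" "x \<in> W" "c \<in> W" "c \<noteq> x"
      "\<forall>A\<in>?F. x \<notin> A \<longrightarrow> c \<in> A \<longrightarrow> (\<exists>A'\<in>?F. x \<notin> A' \<and> c \<notin> A' \<and> A' \<inter> W \<subseteq> A)" for W W' x c
    unfolding that(1)[symmetric]
    by (rule homotopy_eqv_delete_vertex[where ?B1.0 = "{}" and ?w1.0 = c and ?B2.0 = "{}"
          and ?w2.0 = c and c = c]) (use that in auto)
  have 1: "arc_realization {..<3*3+1} 3 homotopy_eqv arc_realization {1,2,3,4,5,6,7,8,9} 3"
    using delete_first_vertex[of 3] unfolding W0 by simp
  have 2: "arc_realization {1,2,3,4,5,6,7,8,9} 3 homotopy_eqv arc_realization {1,2,3,5,6,7,8,9} 3"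
    by (rule step[of _ 4 _ 3]) (simp_all add: cyclic_arcs_3 insert_Diff_if)
  have 3: "arc_realization {1,2,3,5,6,7,8,9} 3 homotopy_eqv arc_realization {1,2,3,5,6,7,9} 3"
    by (rule step[of _ 8 _ 7]) (simp_all add: cyclic_arcs_3 insert_Diff_if)
  have 4: "arc_realization {1,2,3,5,6,7,9} 3 homotopy_eqv arc_realization {1,3,5,6,7,9} 3"
    by (rule step[of _ 2 _ 1]) (simp_all add: cyclic_arcs_3 insert_Diff_if)
  have 5: "arc_realization {1,3,5,6,7,9} 3 homotopy_eqv arc_realization {1,3,5,7,9} 3"
    by (rule step[of _ 6 _ 5]) (simp_all add: cyclic_arcs_3 insert_Diff_if)
  \<comment> \<open>Every arc of three residues contains an odd one, and each odd residue is the
    only odd element of the arc centred at it.\<close>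
  have 6: "avoid_complex {1,3,5,7,9} ?F = {\<sigma>. \<sigma> \<subset> {1,3,5,7,9}}"
  proof (intro equalityI subsetI)
    fix \<sigma> assume "\<sigma> \<in> avoid_complex {1,3,5,7,9} ?F"
    then have "\<sigma> \<subseteq> {1,3,5,7,9}" "\<exists>A\<in>?F. \<sigma> \<inter> A = {}"
      by (simp_all add: avoid_complex_def)
    moreover from this(2) have "\<sigma> \<noteq> {1,3,5,7,9}"
      by (auto simp: cyclic_arcs_3)
    ultimately show "\<sigma> \<in> {\<sigma>. \<sigma> \<subset> {1,3,5,7,9}}"
      by blast
  next
    fix \<sigma> :: "nat set" assume "\<sigma> \<in> {\<sigma>. \<sigma> \<subset> {1,3,5,7,9}}"
    then have \<sigma>: "\<sigma> \<subseteq> {1,3,5,7,9}" "1 \<notin> \<sigma> \<or> 3 \<notin> \<sigma> \<or> 5 \<notin> \<sigma> \<or> 7 \<notin> \<sigma> \<or> 9 \<notin> \<sigma>"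
      by blast+
    then have "0 \<notin> \<sigma>" "2 \<notin> \<sigma>" "4 \<notin> \<sigma>" "6 \<notin> \<sigma>" "8 \<notin> \<sigma>"
      by auto
    with \<sigma> show "\<sigma> \<in> avoid_complex {1,3,5,7,9} ?F"
      by (auto simp: avoid_complex_def cyclic_arcs_3)
  qed
  have 7: "geom_realization {1,3,5,7,9::nat} {\<sigma>. \<sigma> \<subset> {1,3,5,7,9}} homotopy_eqv sphere (0 :: real^4) 1"
    by (intro homeomorphic_imp_homotopy_eqv simplex_boundary_homeomorphic_sphere) simp_all
  show ?thesis
    using homotopy_eqv_trans[OF 1 homotopy_eqv_trans[OF 2 homotopy_eqv_trans[OF 3
          homotopy_eqv_trans[OF 4 homotopy_eqv_trans[OF 5 7[folded 6]]]]]] .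
qed

lemma arc_realization_homotopy_eqv_sphere:
  assumes "k \<ge> 3"
  shows "arc_realization {..<3*k+1} k homotopy_eqv sphere (0 :: real^4) 1"
  using assms
proof (induction k rule: nat_induct_at_least)
  case base
  show ?case by (rule arc_realization_3)
next
  case (Suc m)
  let ?k = "m + 1"
  have k: "?k \<ge> 3"
    using Suc.hyps by simp
  have m: "m \<ge> 1"
    using Suc.hyps by simp
  note relabel = homeomorphic_imp_homotopy_eqv[OF homeomorphic_sym[THEN iffD1, OF relabel_step[OF m]]]
  from homotopy_eqv_trans[OF delete_first_vertex[OF k] homotopy_eqv_trans[OF delete_second_vertex[OF k]
        homotopy_eqv_trans[OF delete_third_vertex[OF k] homotopy_eqv_trans[OF relabel Suc.IH]]]]
  show ?case by simp
qed

section \<open>Independent sets of the squared cycle\<close>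

text \<open>Differences of elements of \<open>{1..n}\<close> lie strictly between \<open>-n\<close>
  and \<open>n\<close>, so reduction modulo \<open>n\<close> adds \<open>n\<close> at most once. The
  result is free of \<open>mod\<close> and open to linear arithmetic.\<close>

lemma sqcycle_adj_iff:
  assumes "n \<ge> 3"
  shows "sqcycle_adj n i j \<longleftrightarrow> i \<in> {1..n} \<and> j \<in> {1..n} \<and>
    (j = i + 1 \<or> j = i + 2 \<or> i = j + 1 \<or> i = j + 2 \<or>
     i + n = j + 1 \<or> i + n = j + 2 \<or> j + n = i + 1 \<or> j + n = i + 2)"
proof (cases "i \<in> {1..n} \<and> j \<in> {1..n}")
  case True
  have "(int b - int a) mod int n = (if a \<le> b then int b - int a else int b - int a + int n)"
    if "a \<in> {1..n}" "b \<in> {1..n}" for a b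
  proof (cases "a \<le> b")
    case True
    with that show ?thesis
      by (auto intro!: mod_pos_pos_trivial)
  next
    case False
    have "(int b - int a) mod int n = (int b - int a + int n) mod int n"
      by simp
    also have "\<dots> = int b - int a + int n"
      using that False by (intro mod_pos_pos_trivial) auto
    finally show ?thesis
      using False by simp
  qed
  with True assms show ?thesis
    unfolding sqcycle_adj_def by (cases i j rule: linorder_cases) auto
qed (auto simp: sqcycle_adj_def)

text \<open>Multiplication by 3 modulo \<open>3 k + 1\<close>, followed by the shift from \<open>0, \<dots>, 3 k\<close> to
  \<open>1, \<dots>, 3 k + 1\<close>.\<close>

definition triple :: "nat \<Rightarrow> nat \<Rightarrow> nat" where
  "triple k i = (if i \<le> k then 3*i + 1 else if i \<le> 2*k then 3*(i - k) else 3*(i - 2*k) - 1)"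

text \<open>The three branches take values congruent to 1, 0 and 2 modulo 3, so the residue tells
  which branch to invert. Surjectivity follows by counting.\<close>

lemma bij_betw_triple: "bij_betw (triple k) {..<3*k+1} {1..3*k+1}"
proof -
  define g where "g x = (if x mod 3 = 1 then x div 3
      else if x mod 3 = 0 then x div 3 + k else x div 3 + 2*k + 1)" for x
  have "g (triple k i) = i" for i
  proof -
    have vals: "(3*j + 1) mod 3 = 1" "(3*j + 1) div 3 = j" "(3*j + 2) mod 3 = 2" "(3*j + 2) div 3 = j"
      for j :: nat
      unfolding mod_mult_self4 by simp_all
    consider "i \<le> k" | j where "i = k + j" "i > k" "i \<le> 2*k" | j where "i = 2*k + 1 + j"
    proof (cases "i \<le> k"; cases "i \<le> 2*k")
      assume "\<not> i \<le> k" "i \<le> 2*k"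
      then show thesis
        using that(2)[of "i - k"] by simp
    next
      assume "\<not> i \<le> k" "\<not> i \<le> 2*k"
      then show thesis
        using that(3)[of "i - (2*k+1)"] by simp
    qed (use that(1) in auto)
    then show ?thesis
    proof cases
      case 1
      then have "triple k i = 3*i + 1"
        by (simp add: triple_def)
      then show ?thesis
        by (simp only: g_def vals) simp
    next
      case 2
      then have "triple k i = 3*j"
        by (simp add: triple_def)
      then show ?thesis
        using 2 by (simp add: g_def)
    next
      case 3
      then have "triple k i = 3*j + 2"
        by (simp add: triple_def)
      then show ?thesis
        using 3 by (simp only: g_def vals) simp
    qed
  qed
  then have "inj_on (triple k) {..<3*k+1}"
    by (rule inj_on_inverseI)
  moreover have "triple k ` {..<3*k+1} \<subseteq> {1..3*k+1}"
    by (auto simp: triple_def)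
  ultimately show ?thesis
    unfolding bij_betw_def by (metis card_atLeastAtMost card_image card_lessThan card_subset_eq
        diff_Suc_1 finite_atLeastAtMost Suc_eq_plus1)
qed

lemma triple_inject: "u < 3*k+1 \<Longrightarrow> v < 3*k+1 \<Longrightarrow> triple k u = triple k v \<Longrightarrow> u = v"
  using bij_betw_triple[of k] by (auto simp: bij_betw_def inj_on_def)

text \<open>Since \<open>3 k \<equiv> -1\<close>, vertices at cyclic distance 1 or 2 come from positions at cyclic
  distance \<open>k\<close> or \<open>2 k\<close>.\<close>

lemma triple_near_imp:
  assumes k: "k \<ge> 1" and uv: "u < 3*k+1" "v < 3*k+1"
    and near: "triple k v = triple k u + 1 \<or> triple k v = triple k u + 2 \<or>
      triple k v + (3*k+1) = triple k u + 1 \<or> triple k v + (3*k+1) = triple k u + 2"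
  shows "u = v + k \<or> v = u + 2*k + 1 \<or> v = u + k + 1 \<or> u = v + 2*k"
proof -
  have range: "1 \<le> triple k u" "1 \<le> triple k v" "triple k u \<le> 3*k+1" "triple k v \<le> 3*k+1"
    using uv by (auto simp: triple_def)
  \<comment> \<open>The positions of the four values 1, 2, \<open>3*k\<close>, \<open>3*k+1\<close>
    at which adding 1 or 2 can wrap around.\<close>
  have ends: "triple k 0 = 1" "triple k k = 3*k+1" "triple k (2*k) = 3*k" "triple k (2*k+1) = 2"
    using k by (auto simp: triple_def)
  consider (one) "triple k v = triple k u + 1" | (two) "triple k v = triple k u + 2"
    | (wrap) "triple k v = 1" "triple k u = 3*k+1" | (wrap1) "triple k v = 1" "triple k u = 3*k"
    | (wrap2) "triple k v = 2" "triple k u = 3*k+1"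
    using near range by linarith
  then show ?thesis
  proof cases
    case one
    \<comment> \<open>As \<open>3*(-k)\<close> is 1 modulo \<open>3*k+1\<close>, adding 1 to the
      value moves the position by \<open>-k\<close>, equivalently by \<open>2*k+1\<close>.\<close>
    define w where "w = (if u \<le> k then u + 2*k + 1 else u - k)"
    have "w < 3*k+1" "triple k w = triple k u + 1"
      using uv range(4) one by (auto simp: w_def triple_def split: if_splits)
    then have "v = w"
      using triple_inject uv one by metis
    then show ?thesis
      by (auto simp: w_def)
  next
    case two
    \<comment> \<open>Adding 2 to the value moves the position by \<open>-2*k\<close>, equivalently
      by \<open>k+1\<close>.\<close>
    define w where "w = (if u \<le> 2*k then u + k + 1 else u - 2*k)"
    have "w < 3*k+1" "triple k w = triple k u + 2"
      using uv range(4) two by (auto simp: w_def triple_def split: if_splits)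
    then have "v = w"
      using triple_inject uv two by metis
    then show ?thesis
      by (auto simp: w_def)
  next
    case wrap
    then have "v = 0" "u = k"
      using triple_inject[of v k 0] triple_inject[of u k k] uv ends by auto
    then show ?thesis by simp
  next
    case wrap1
    then have "v = 0" "u = 2*k"
      using triple_inject[of v k 0] triple_inject[of u k "2*k"] uv ends by auto
    then show ?thesis by simp
  next
    case wrap2
    then have "v = 2*k+1" "u = k"
      using triple_inject[of v k "2*k+1"] triple_inject[of u k k] uv ends k by auto
    then show ?thesis by simp
  qed
qed

text \<open>Adjacency forces the positions to differ by \<open>k\<close>, \<open>k+1\<close>,
  \<open>2*k\<close> or \<open>2*k+1\<close>. Two positions in one arc differ by less than
  \<open>k\<close>, or by at least \<open>2*k+2\<close> if they lie in different pieces of a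
  wrapping arc.\<close>

lemma triple_not_adj:
  assumes k: "k \<ge> 1" and uv: "u < 3*k+1" "v < 3*k+1"
    and dist: "v < u + k \<and> u < v + k \<or> u + 2*k + 2 \<le> v \<or> v + 2*k + 2 \<le> u"
  shows "\<not> sqcycle_adj (3*k+1) (triple k u) (triple k v)"
proof
  assume "sqcycle_adj (3*k+1) (triple k u) (triple k v)"
  then have "(u = v + k \<or> v = u + 2*k + 1 \<or> v = u + k + 1 \<or> u = v + 2*k) \<or>
      (v = u + k \<or> u = v + 2*k + 1 \<or> u = v + k + 1 \<or> v = u + 2*k)"
    using triple_near_imp[OF k uv] triple_near_imp[OF k uv(2,1)] k sqcycle_adj_iff[of "3*k+1"] by auto
  then show False
    using dist by auto
qed

lemma cyclic_arc_subset: "A \<in> cyclic_arcs k \<Longrightarrow> A \<subseteq> {..<3*k+1}"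
  by (cases rule: cyclic_arcsE) auto

lemma card_cyclic_arc:
  assumes "A \<in> cyclic_arcs k"
  shows "card A = k"
  using assms
proof (cases rule: cyclic_arcsE)
  case (outer a)
  have "card ({..<a} \<union> {2*k+1+a..<3*k+1}) = card {..<a} + card {2*k+1+a..<3*k+1}"
    by (intro card_Un_disjoint) auto
  with outer show ?thesis by simp
qed simp

lemma independent_triple_arc:
  assumes k: "k \<ge> 1" and A: "A \<in> cyclic_arcs k"
  shows "independent_set {1..3*k+1} (sqcycle_adj (3*k+1)) (triple k ` A)"
  unfolding independent_set_def
proof (intro conjI ballI)
  show "triple k ` A \<subseteq> {1..3*k+1}"
    using cyclic_arc_subset[OF A] bij_betw_triple[of k] by (auto simp: bij_betw_def)
  fix x y assume "x \<in> triple k ` A" "y \<in> triple k ` A"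
  then obtain u v where uv: "u \<in> A" "v \<in> A" "x = triple k u" "y = triple k v"
    by blast
  have "v < u + k \<and> u < v + k \<or> u + 2*k + 2 \<le> v \<or> v + 2*k + 2 \<le> u"
    using A uv(1,2) by (cases rule: cyclic_arcsE) auto
  moreover have "u < 3*k+1" "v < 3*k+1"
    using cyclic_arc_subset[OF A] uv by auto
  ultimately show "\<not> sqcycle_adj (3*k+1) x y"
    using triple_not_adj[OF k] uv by blast
qed

text \<open>The \<open>k\<close> cyclic gaps are at least 3 and add up to \<open>3*k+1\<close>, so
  one gap is 4 and the others are 3. Here \<open>s\<close> is the smallest element and
  \<open>t\<close> counts the elements before the gap of 4; \<open>t = k\<close> puts that gap at
  the wrap-around.\<close>

lemma independent_set_shape:
  assumes k: "k \<ge> 1" and S: "independent_set {1..3*k+1} (sqcycle_adj (3*k+1)) S" "card S = k"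
  obtains s t where "1 \<le> s" "s \<le> 3 \<or> s = 4 \<and> t = k" "1 \<le> t" "t \<le> k"
    "\<And>i. i < t \<Longrightarrow> s + 3*i \<in> S" "\<And>i. t \<le> i \<Longrightarrow> i < k \<Longrightarrow> s + 3*i + 1 \<in> S"
proof -
  have sub: "S \<subseteq> {1..3*k+1}"
    using S by (simp add: independent_set_def)
  have fin: "finite S"
    using sub finite_subset by blast
  define f where "f i = sorted_list_of_set S ! i" for i
  have len: "length (sorted_list_of_set S) = k"
    using S fin by simp
  have f_in: "f i \<in> S" if "i < k" for i
    using that len fin nth_mem[of i "sorted_list_of_set S"] by (simp add: f_def)
  have f_range: "1 \<le> f i" "f i \<le> 3*k+1" if "i < k" for i
    using f_in[OF that] sub by auto
  have f_less: "f i < f j" if "i < j" "j < k" for i j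
    using that len sorted_wrt_nth_less[OF strict_sorted_list_of_set[of S]] by (simp add: f_def)
  have nadj: "f j \<noteq> f i + 1" "f j \<noteq> f i + 2" "f i + (3*k+1) \<noteq> f j + 1" "f i + (3*k+1) \<noteq> f j + 2"
    if "i < k" "j < k" for i j
  proof -
    have "\<not> sqcycle_adj (3*k+1) (f i) (f j)"
      using S f_in that by (auto simp: independent_set_def)
    then show "f j \<noteq> f i + 1" "f j \<noteq> f i + 2" "f i + (3*k+1) \<noteq> f j + 1" "f i + (3*k+1) \<noteq> f j + 2"
      using f_range that k sqcycle_adj_iff[of "3*k+1" "f i" "f j"] by auto
  qed
  have gap: "f i + 3 \<le> f (Suc i)" if "Suc i < k" for i
  proof -
    have "i < k"
      using that by simp
    from nadj(1,2)[OF this that] f_less[OF _ that, of i] show ?thesis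
      by simp
  qed
  \<comment> \<open>The cyclic gap from the last element back to the first is at least 3 as
    well.\<close>
  have wrap: "f (k - 1) + 2 \<le> f 0 + 3*k"
  proof (cases "k = 1")
    case False
    have "0 < k" "k - 1 < k"
      using k by auto
    from nadj(3,4)[OF this] f_range(1)[OF this(1)] f_range(2)[OF this(2)] show ?thesis
      by linarith
  qed simp
  have gaps: "f i + 3*j \<le> f (i + j)" if "i + j < k" for i j
    using that
  proof (induction j)
    case (Suc j)
    with gap[of "i + j"] show ?case by simp
  qed simp
  have lower: "f 0 + 3*i \<le> f i" if "i < k" for i
    using gaps[of 0 i] that by simp
  \<comment> \<open>The gaps after \<open>f i\<close>, including the wrap-around, leave only one
    unit of slack.\<close>
  have upper: "f i \<le> f 0 + 3*i + 1" if "i < k" for i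
    using gaps[of i "k - 1 - i"] wrap that by simp
  \<comment> \<open>The first index that has used up the slack; the default \<open>k\<close> stands
    for none.\<close>
  define t where "t = (LEAST i. i = k \<or> f i = f 0 + 3*i + 1)"
  have t: "t = k \<or> f t = f 0 + 3*t + 1"
    unfolding t_def by (rule LeastI[of _ k]) simp
  have t_le: "t \<le> k"
    unfolding t_def by (rule Least_le) simp
  have before: "f i = f 0 + 3*i" if "i < t" for i
  proof -
    have "\<not> (i = k \<or> f i = f 0 + 3*i + 1)"
      using that unfolding t_def by (rule not_less_Least)
    then show ?thesis
      using that t_le lower[of i] upper[of i] by auto
  qed
  have after: "f i = f 0 + 3*i + 1" if "t \<le> i" "i < k" for i
    using gaps[of t "i - t"] t upper[of i] that by auto
  show thesis
  proof
    show "1 \<le> f 0"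
      using f_range k by simp
    show "1 \<le> t"
      using t k by (cases t) auto
    show "t \<le> k"
      by (rule t_le)
    \<comment> \<open>The last element is at most \<open>3*k+1\<close>; this bounds the first by 4,
      and by 3 if the last one is shifted.\<close>
    show "f 0 \<le> 3 \<or> f 0 = 4 \<and> t = k"
    proof (cases "t = k")
      case True
      then show ?thesis
        using before[of "k - 1"] f_range[of "k - 1"] k by auto
    next
      case False
      then show ?thesis
        using after[of "k - 1"] f_range[of "k - 1"] k t_le by auto
    qed
    show "f 0 + 3*i \<in> S" if "i < t" for i
      using before[OF that] f_in[of i] that t_le by simp
    show "f 0 + 3*i + 1 \<in> S" if "t \<le> i" "i < k" for i
      using after[OF that] f_in[of i] that by simp
  qed
qed

text \<open>Values congruent to 1, 0, 2 modulo 3 sit at positions \<open>0..k\<close>,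
  \<open>k+1..2*k\<close>, \<open>2*k+1..3*k\<close>. So each of the two progressions in
  \<open>S\<close> fills a run of positions, and the runs join, cyclically, into an arc.\<close>

lemma independent_set_contains_arc:
  assumes k: "k \<ge> 1" and S: "independent_set {1..3*k+1} (sqcycle_adj (3*k+1)) S" "card S = k"
  shows "\<exists>A\<in>cyclic_arcs k. triple k ` A \<subseteq> S"
proof -
  obtain s t where s: "1 \<le> s" "s \<le> 3 \<or> s = 4 \<and> t = k" and t: "1 \<le> t" "t \<le> k"
    and S1: "\<And>i. i < t \<Longrightarrow> s + 3*i \<in> S" and S2: "\<And>i. t \<le> i \<Longrightarrow> i < k \<Longrightarrow> s + 3*i + 1 \<in> S"
    by (rule independent_set_shape[OF assms]) (rule that; blast)
  \<comment> \<open>For \<open>s = 1\<close> the runs meet across the wrap-around when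
    \<open>t < k\<close>; for \<open>s = 2\<close> they meet at \<open>2*k+1\<close> and for
    \<open>s = 3\<close> at \<open>k+1\<close>, with the shifted progression first.\<close>
  consider "s = 1" "t < k" | "s = 1" "t = k" | "s = 2" | "s = 3" | "s = 4" "t = k"
    using s t by linarith
  then show ?thesis
  proof cases
    case 1
    have "triple k v \<in> S" if v: "v \<in> {..<t} \<union> {2*k+1+t..<3*k+1}" for v
    proof (cases "v < t")
      case True
      then have "triple k v = s + 3 * v"
        using 1 by (auto simp: triple_def)
      then show ?thesis
        using S1[OF True] by simp
    next
      case False
      then have "triple k v = s + 3*(v - (2*k+1)) + 1"
        using v 1 by (auto simp: triple_def)
      then show ?thesis
        using S2[of "v - (2*k+1)"] v False by auto
    qed
    then show ?thesis
      using outer_arc[of t k] 1 by blast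
  next
    case 2
    have "triple k v \<in> S" if "v \<in> {0..<0+k}" for v
      using that S1[of v] 2 by (auto simp: triple_def)
    then show ?thesis
      using t by (intro bexI[OF _ inner_arc[of 0]]) auto
  next
    case 3
    have "triple k v \<in> S" if v: "v \<in> {k+1+t..<k+1+t+k}" for v
    proof (cases "v \<le> 2*k")
      case True
      then have "triple k v = s + 3*(v - (k+1)) + 1"
        using v 3 by (auto simp: triple_def)
      then show ?thesis
        using S2[of "v - (k+1)"] v True by auto
    next
      case False
      then have "triple k v = s + 3*(v - (2*k+1))"
        using v 3 by (auto simp: triple_def)
      then show ?thesis
        using S1[of "v - (2*k+1)"] v False by auto
    qed
    then show ?thesis
      using t by (intro bexI[OF _ inner_arc[of "k+1+t"]]) auto
  next
    case 4
    have "triple k v \<in> S" if v: "v \<in> {t+1..<t+1+k}" for v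
    proof (cases "v \<le> k")
      case True
      then have "triple k v = s + 3*(v - 1) + 1"
        using v 4 by (auto simp: triple_def)
      then show ?thesis
        using S2[of "v - 1"] v True by auto
    next
      case False
      then have "triple k v = s + 3*(v - (k+1))"
        using v 4 t by (auto simp: triple_def)
      then show ?thesis
        using S1[of "v - (k+1)"] v False by auto
    qed
    then show ?thesis
      using t by (intro bexI[OF _ inner_arc[of "t+1"]]) auto
  next
    case 5
    have "triple k v \<in> S" if v: "v \<in> {1..<1+k}" for v
    proof -
      have "triple k v = s + 3*(v - 1)"
        using v 5 by (auto simp: triple_def)
      then show ?thesis
        using S1[of "v - 1"] v 5 by auto
    qed
    then show ?thesis
      using t by (intro bexI[OF _ inner_arc[of 1]]) auto
  qed
qed

lemma total_cut_complex_eq_avoid_complex: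
  "total_cut_complex k V E = avoid_complex V {S. independent_set V E S \<and> card S = k}"
proof -
  have "S \<subseteq> V - \<sigma> \<and> independent_set V E S \<and> card S = k \<longleftrightarrow>
      (independent_set V E S \<and> card S = k) \<and> \<sigma> \<inter> S = {}" for S \<sigma>
  proof (cases "S \<subseteq> V")
    case True
    then show ?thesis by blast
  qed (auto simp: independent_set_def)
  then show ?thesis
    by (simp only: total_cut_complex_def avoid_complex_def Bex_def mem_Collect_eq)
qed

theorem theorem4p2:
  fixes k :: nat
  assumes "k \<ge> 3"
  shows "geom_realization {1..3*k+1}
           (total_cut_complex k {1..3*k+1} (sqcycle_adj (3*k+1)))
         homotopy_eqv sphere (0 :: real^4) 1"
proof -
  have k: "k \<ge> 1"
    using assms by simp
  let ?F = "{S. independent_set {1..3*k+1} (sqcycle_adj (3*k+1)) S \<and> card S = k}"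
  have "arc_realization {..<3*k+1} k homeomorphic
        geom_realization {1..3*k+1} (avoid_complex {1..3*k+1} ?F)"
  proof (rule homeomorphic_avoid_complex[OF _ bij_betw_triple])
    show "\<exists>S\<in>?F. S \<inter> {1..3*k+1} \<subseteq> triple k ` (A \<inter> {..<3*k+1})" if A: "A \<in> cyclic_arcs k" for A
    proof (rule bexI)
      show "triple k ` A \<inter> {1..3*k+1} \<subseteq> triple k ` (A \<inter> {..<3*k+1})"
        using cyclic_arc_subset[OF A] by blast
      have "inj_on (triple k) A"
        by (rule inj_on_subset[OF bij_betw_imp_inj_on[OF bij_betw_triple] cyclic_arc_subset[OF A]])
      then have "card (triple k ` A) = k"
        using card_cyclic_arc[OF A] by (simp add: card_image)
      then show "triple k ` A \<in> ?F"
        using independent_triple_arc[OF k A] by simp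
    qed
    show "\<exists>A\<in>cyclic_arcs k. triple k ` (A \<inter> {..<3*k+1}) \<subseteq> S" if "S \<in> ?F" for S
    proof -
      obtain A where "A \<in> cyclic_arcs k" "triple k ` A \<subseteq> S"
        using independent_set_contains_arc[OF k, of S] \<open>S \<in> ?F\<close> by auto
      then show ?thesis
        by (intro bexI[of _ A]) auto
    qed
  qed simp
  then have "geom_realization {1..3*k+1} (avoid_complex {1..3*k+1} ?F) homotopy_eqv
      arc_realization {..<3*k+1} k"
    by (rule homeomorphic_imp_homotopy_eqv[OF homeomorphic_sym[THEN iffD1]])
  from homotopy_eqv_trans[OF this arc_realization_homotopy_eqv_sphere[OF assms]] show ?thesis
    by (simp add: total_cut_complex_eq_avoid_complex)
qed

end
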